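(* Let $\mathcal A$ be a strong $U$-structure with universe $A$, let $k\le n$ and let $\bar a,\bar b\in{}^kA$ be such that for every $\mathcal L_n$-formula $\varphi$ of the vocabulary of $\mathcal A$ with free variables among $v_0,\dots,v_{k-1}$, $\mathcal A\models\varphi[\bar a]$ iff $\mathcal A\models\varphi[\bar b]$. Then there is an automorphism of $\mathcal A$ mapping $\bar a$ onto $\bar b$.
   Context: Fix a natural number $n$. All vocabularies consist of relation symbols only; equality is always available. $\mathcal{L}_n$ is first-order logic using only the variables $v_0,\dots,v_{n-1}$. For $\bar s\in{}^kA$, $\ker(\bar s)=\{(i,j)\in k\times k:s_i=s_j\}$; for $U_0\subseteq A$, $\bar s\sim\bar z$ iff $\ker(\bar s)=\ker(\bar z)$ and $s_i\in U_0\iff z_i\in U_0$ for all $i<k$. $A^{*m}$ is the set of $m$-tuples of $A$ with pairwise distinct entries. A $U$-structure is a relational structure $\mathcal A$ with universe $A$ together with a subset $U_0\subseteq A$ (the core, not named in the vocabulary) with $|U_0|\ge n$, $|A\setminus U_0|\ge n$, every basic relation closed under $\sim$. "Definable" means definable without parameters by an $\mathcal L_n$-formula of the relevant vocabulary. A $U$-structure is strong if for every sub-vocabulary $W$ such that $U_0$ is not definable in $\mathcal A|_W$, every $m\le n$, every $m$-ary $R\subseteq A^{*m}$ definable in $\mathcal A|_W$ and all distinct $i,j<m$: $\mathcal A\models\forall\bar v[R(\bar v)\leftrightarrow(\exists v_iR(\bar v)\wedge\exists v_jR(\bar v)\wedge A^{*m}(\bar v))]$. An automorphism is a permutation of $A$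 preserving all basic relations (the core need not be preserved).
   Formalization: The formal statement adds that every relation symbol has arity at most n; without this the claim fails, e.g. for one (n+1)-ary relation of distinct tuples with first entry in the core and the rest outside, which no L_n-formula can see. *)

theory Defs
  imports Main
begin

record ('a, 'r) rel_structure =
  universe :: "'a set"
  vocab :: "'r set"
  arity :: "'r \<Rightarrow> nat"
  interp :: "'r \<Rightarrow> 'a list set"

definition tuples :: "nat \<Rightarrow> 'a set \<Rightarrow> 'a list set" where
  "tuples k A = {s. length s = k \<and> set s \<subseteq> A}"

definition distinct_tuples :: "nat \<Rightarrow> 'a set \<Rightarrow> 'a list set" where
  "distinct_tuples m A = {s \<in> tuples m A. distinct s}"

definition rel_structure :: "('a, 'r) rel_structure \<Rightarrow> bool" where
  "rel_structure \<AA> \<longleftrightarrow> (\<forall>r \<in> vocab \<AA>. interp \<AA> r \<subseteq> tuples (arity \<AA> r) (universe \<AA>))"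

definition reduct :: "('a, 'r) rel_structure \<Rightarrow> 'r set \<Rightarrow> ('a, 'r) rel_structure" where
  "reduct \<AA> W = \<AA>\<lparr>vocab := W\<rparr>"

definition automorphism :: "('a, 'r) rel_structure \<Rightarrow> ('a \<Rightarrow> 'a) \<Rightarrow> bool" where
  "automorphism \<AA> f \<longleftrightarrow>
     bij_betw f (universe \<AA>) (universe \<AA>) \<and>
     (\<forall>r \<in> vocab \<AA>. \<forall>s \<in> tuples (arity \<AA> r) (universe \<AA>).
        s \<in> interp \<AA> r \<longleftrightarrow> map f s \<in> interp \<AA> r)"

datatype 'r form =
    Falsum
  | Eq nat nat
  | Rel 'r "nat list"
  | Neg "'r form"
  | Conj "'r form" "'r form"
  | Ex nat "'r form"

fun free_vars :: "'r form \<Rightarrow> nat set" where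
  "free_vars Falsum = {}"
| "free_vars (Eq i j) = {i, j}"
| "free_vars (Rel r is) = set is"
| "free_vars (Neg \<phi>) = free_vars \<phi>"
| "free_vars (Conj \<phi> \<psi>) = free_vars \<phi> \<union> free_vars \<psi>"
| "free_vars (Ex i \<phi>) = free_vars \<phi> - {i}"

text \<open>Membership in \<open>\<L>\<^sub>n\<close> over the vocabulary \<open>W\<close> with arities \<open>ar\<close>: every variable,
  free or bound, is one of \<open>v\<^sub>0, \<dots>, v\<^sub>n\<^sub>-\<^sub>1\<close>.  Variables may be repeated in atomic formulas.\<close>

fun in_L :: "nat \<Rightarrow> 'r set \<Rightarrow> ('r \<Rightarrow> nat) \<Rightarrow> 'r form \<Rightarrow> bool" where
  "in_L n W ar Falsum \<longleftrightarrow> True"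
| "in_L n W ar (Eq i j) \<longleftrightarrow> i < n \<and> j < n"
| "in_L n W ar (Rel r is) \<longleftrightarrow> r \<in> W \<and> length is = ar r \<and> (\<forall>i \<in> set is. i < n)"
| "in_L n W ar (Neg \<phi>) \<longleftrightarrow> in_L n W ar \<phi>"
| "in_L n W ar (Conj \<phi> \<psi>) \<longleftrightarrow> in_L n W ar \<phi> \<and> in_L n W ar \<psi>"
| "in_L n W ar (Ex i \<phi>) \<longleftrightarrow> i < n \<and> in_L n W ar \<phi>"

text \<open>The formulas of \<open>\<L>\<^sub>n\<close> in the vocabulary of \<open>\<AA>\<close> with free variables among
  \<open>v\<^sub>0, \<dots>, v\<^sub>k\<^sub>-\<^sub>1\<close>.\<close>

definition L_forms :: "nat \<Rightarrow> ('a, 'r) rel_structure \<Rightarrow> nat \<Rightarrow> 'r form set" where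
  "L_forms n \<AA> k = {\<phi>. in_L n (vocab \<AA>) (arity \<AA>) \<phi> \<and> free_vars \<phi> \<subseteq> {..<k}}"

fun sat :: "('a, 'r) rel_structure \<Rightarrow> (nat \<Rightarrow> 'a) \<Rightarrow> 'r form \<Rightarrow> bool" where
  "sat \<AA> e Falsum \<longleftrightarrow> False"
| "sat \<AA> e (Eq i j) \<longleftrightarrow> e i = e j"
| "sat \<AA> e (Rel r is) \<longleftrightarrow> map e is \<in> interp \<AA> r"
| "sat \<AA> e (Neg \<phi>) \<longleftrightarrow> \<not> sat \<AA> e \<phi>"
| "sat \<AA> e (Conj \<phi> \<psi>) \<longleftrightarrow> sat \<AA> e \<phi> \<and> sat \<AA> e \<psi>"
| "sat \<AA> e (Ex i \<phi>) \<longleftrightarrow> (\<exists>x \<in> universe \<AA>. sat \<AA> (e(i := x)) \<phi>)"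

text \<open>\<open>\<AA> \<Turnstile> \<phi>[s]\<close>, used only for formulas with free variables among \<open>v\<^sub>0, \<dots>, v\<^sub>k\<^sub>-\<^sub>1\<close> with
  \<open>k = length s\<close>, so the unspecified values of \<open>s ! i\<close> for \<open>i \<ge> k\<close> are irrelevant.\<close>

definition sat_tuple :: "('a, 'r) rel_structure \<Rightarrow> 'r form \<Rightarrow> 'a list \<Rightarrow> bool" where
  "sat_tuple \<AA> \<phi> s \<longleftrightarrow> sat \<AA> (\<lambda>i. s ! i) \<phi>"

definition definable :: "nat \<Rightarrow> ('a, 'r) rel_structure \<Rightarrow> nat \<Rightarrow> 'a list set \<Rightarrow> bool" where
  "definable n \<AA> m R \<longleftrightarrow>
     (\<exists>\<phi> \<in> L_forms n \<AA> m. R = {s \<in> tuples m (universe \<AA>). sat_tuple \<AA> \<phi> s})"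

definition definable_set :: "nat \<Rightarrow> ('a, 'r) rel_structure \<Rightarrow> 'a set \<Rightarrow> bool" where
  "definable_set n \<AA> X \<longleftrightarrow> definable n \<AA> 1 {[x] | x. x \<in> X}"

definition ker :: "'a list \<Rightarrow> (nat \<times> nat) set" where
  "ker s = {(i, j). i < length s \<and> j < length s \<and> s ! i = s ! j}"

definition sim :: "'a set \<Rightarrow> 'a list \<Rightarrow> 'a list \<Rightarrow> bool" where
  "sim U\<^sub>0 s z \<longleftrightarrow> length s = length z \<and> ker s = ker z \<and>
     (\<forall>i < length s. s ! i \<in> U\<^sub>0 \<longleftrightarrow> z ! i \<in> U\<^sub>0)"

definition at_least :: "nat \<Rightarrow> 'a set \<Rightarrow> bool" where
  "at_least n X \<longleftrightarrow> infinite X \<or> n \<le> card X"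

text \<open>Relation symbols of the language with variables \<open>v\<^sub>0, \<dots>, v\<^sub>n\<^sub>-\<^sub>1\<close> have arity at most \<open>n\<close>,
  as usual in finite-variable logic.  A basic relation of larger arity could separate \<open>U\<^sub>0\<close> from
  its complement on tuples of distinct elements without being visible to any \<open>\<L>\<^sub>n\<close>-formula.\<close>

definition U_structure :: "nat \<Rightarrow> ('a, 'r) rel_structure \<Rightarrow> 'a set \<Rightarrow> bool" where
  "U_structure n \<AA> U\<^sub>0 \<longleftrightarrow>
     rel_structure \<AA> \<and>
     (\<forall>r \<in> vocab \<AA>. arity \<AA> r \<le> n) \<and>
     U\<^sub>0 \<subseteq> universe \<AA> \<and>
     at_least n U\<^sub>0 \<and> at_least n (universe \<AA> - U\<^sub>0) \<and>
     (\<forall>r \<in> vocab \<AA>. \<forall>s \<in> interp \<AA> r. \<forall>z \<in> tuples (arity \<AA> r) (universe \<AA>).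
        sim U\<^sub>0 s z \<longrightarrow> z \<in> interp \<AA> r)"

text \<open>The displayed equivalence is the truth in \<open>\<AA>\<close> of
  \<open>\<forall>v [R(v) \<longleftrightarrow> (\<exists>v\<^sub>i R(v) \<and> \<exists>v\<^sub>j R(v) \<and> A\<^sup>*\<^sup>m(v))]\<close>.\<close>

definition strong_U_structure :: "nat \<Rightarrow> ('a, 'r) rel_structure \<Rightarrow> 'a set \<Rightarrow> bool" where
  "strong_U_structure n \<AA> U\<^sub>0 \<longleftrightarrow>
     U_structure n \<AA> U\<^sub>0 \<and>
     (\<forall>W \<subseteq> vocab \<AA>. \<not> definable_set n (reduct \<AA> W) U\<^sub>0 \<longrightarrow>
       (\<forall>m \<le> n. \<forall>R \<subseteq> distinct_tuples m (universe \<AA>). definable n (reduct \<AA> W) m R \<longrightarrow>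
         (\<forall>i < m. \<forall>j < m. i \<noteq> j \<longrightarrow>
           (\<forall>v \<in> tuples m (universe \<AA>).
              v \<in> R \<longleftrightarrow>
                (\<exists>x \<in> universe \<AA>. v[i := x] \<in> R) \<and>
                (\<exists>x \<in> universe \<AA>. v[j := x] \<in> R) \<and>
                v \<in> distinct_tuples m (universe \<AA>)))))"

end

theory Submission
  imports Defs "HOL-Combinatorics.Transposition"
begin

text \<open>Every permutation of the universe that preserves the core is an automorphism, because the
  basic relations are closed under \<open>\<sim>\<close>.  If the core is definable, then \<open>a \<sim> b\<close>, and the finite
  partial map \<open>a \<mapsto> b\<close> extends to a permutation preserving the core.  If the core is not definable,
  then the definable subsets of the universe, being unions of the core and its complement, are
  trivial; strongness lifts this to all arities: a definable set of distinct tuples is empty or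
  consists of all distinct tuples.  Hence every permutation of the universe is an automorphism, and
  any permutation extending \<open>a \<mapsto> b\<close> will do.\<close>

section \<open>Satisfaction: locality and invariance under automorphisms\<close>

lemma sat_cong:
  assumes "\<And>i. i \<in> free_vars \<phi> \<Longrightarrow> e i = e' i"
  shows "sat \<AA> e \<phi> \<longleftrightarrow> sat \<AA> e' \<phi>"
  using assms
proof (induction \<phi> arbitrary: e e')
  case (Rel r vs)
  then have "map e vs = map e' vs" by simp
  then show ?case by (simp only: sat.simps)
next
  case (Neg \<phi>)
  have "sat \<AA> e \<phi> \<longleftrightarrow> sat \<AA> e' \<phi>" using Neg.prems by (intro Neg.IH) simp
  then show ?case by simp
next
  case (Conj \<phi> \<psi>)
  have "sat \<AA> e \<phi> \<longleftrightarrow> sat \<AA> e' \<phi>" using Conj.prems by (intro Conj.IH) simp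
  moreover have "sat \<AA> e \<psi> \<longleftrightarrow> sat \<AA> e' \<psi>" using Conj.prems by (intro Conj.IH) simp
  ultimately show ?case by simp
next
  case (Ex i \<phi>)
  have "sat \<AA> (e(i := x)) \<phi> \<longleftrightarrow> sat \<AA> (e'(i := x)) \<phi>" for x
    using Ex.prems by (intro Ex.IH) simp
  then show ?case by simp
qed simp_all

lemma sat_tuple_map_upt:
  assumes "free_vars \<phi> \<subseteq> {..<m}"
  shows "sat_tuple \<AA> \<phi> (map e [0..<m]) \<longleftrightarrow> sat \<AA> e \<phi>"
  unfolding sat_tuple_def using assms by (intro sat_cong) auto

text \<open>An automorphism is controlled only on the universe, so the free variables must take
  values there; other values of \<open>e\<close> may be arbitrary, as happens for assignments
  \<open>(!) s\<close> beyond the length of \<open>s\<close>.\<close>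

lemma sat_automorphism:
  assumes f: "automorphism \<AA> f"
    and "in_L n (vocab \<AA>) (arity \<AA>) \<phi>" "e ` free_vars \<phi> \<subseteq> universe \<AA>"
  shows "sat \<AA> (f \<circ> e) \<phi> \<longleftrightarrow> sat \<AA> e \<phi>"
  using assms(2,3)
proof (induction \<phi> arbitrary: e)
  case (Eq i j)
  then show ?case using f by (auto simp: automorphism_def bij_betw_def inj_on_def)
next
  case (Rel r vs)
  then have "map e vs \<in> tuples (arity \<AA> r) (universe \<AA>)" by (auto simp: tuples_def)
  then have "map e vs \<in> interp \<AA> r \<longleftrightarrow> map f (map e vs) \<in> interp \<AA> r"
    using f Rel by (auto simp: automorphism_def)
  then show ?case by (simp add: comp_def)
next
  case (Ex i \<phi>)
  have image: "f ` universe \<AA> = universe \<AA>" using f by (auto simp: automorphism_def bij_betw_def)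
  have "sat \<AA> ((f \<circ> e)(i := f x)) \<phi> \<longleftrightarrow> sat \<AA> (e(i := x)) \<phi>" if "x \<in> universe \<AA>" for x
  proof -
    have "sat \<AA> (f \<circ> e(i := x)) \<phi> \<longleftrightarrow> sat \<AA> (e(i := x)) \<phi>"
      using Ex.prems that by (intro Ex.IH) auto
    then show ?thesis by (simp only: fun_upd_comp)
  qed
  \<comment> \<open>Surjectivity of \<open>f\<close> lets every witness be written as
    \<open>f x\<close>.\<close>
  moreover have "(\<exists>y \<in> universe \<AA>. sat \<AA> ((f \<circ> e)(i := y)) \<phi>) \<longleftrightarrow>
      (\<exists>x \<in> universe \<AA>. sat \<AA> ((f \<circ> e)(i := f x)) \<phi>)"
    using image by (metis (no_types, lifting) imageE imageI)
  ultimately show ?case unfolding sat.simps by simp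
qed (auto simp: image_Un)

section \<open>Injective renaming of variables\<close>

text \<open>Bound variables are renamed as well: for injective \<sigma> nothing is captured, and no
  fresh variable is required, which matters when only n variables exist.\<close>

fun rename :: "(nat \<Rightarrow> nat) \<Rightarrow> 'r form \<Rightarrow> 'r form" where
  "rename \<sigma> Falsum = Falsum"
| "rename \<sigma> (Eq i j) = Eq (\<sigma> i) (\<sigma> j)"
| "rename \<sigma> (Rel r vs) = Rel r (map \<sigma> vs)"
| "rename \<sigma> (Neg \<phi>) = Neg (rename \<sigma> \<phi>)"
| "rename \<sigma> (Conj \<phi> \<psi>) = Conj (rename \<sigma> \<phi>) (rename \<sigma> \<psi>)"
| "rename \<sigma> (Ex i \<phi>) = Ex (\<sigma> i) (rename \<sigma> \<phi>)"

lemma free_vars_rename: "inj \<sigma> \<Longrightarrow> free_vars (rename \<sigma> \<phi>) = \<sigma> ` free_vars \<phi>"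
  by (induction \<phi>) (auto simp: image_Un image_set_diff)

lemma in_L_rename:
  "in_L n W ar \<phi> \<Longrightarrow> (\<And>i. i < n \<Longrightarrow> \<sigma> i < n) \<Longrightarrow> in_L n W ar (rename \<sigma> \<phi>)"
  by (induction \<phi>) auto

lemma sat_rename: "inj \<sigma> \<Longrightarrow> sat \<AA> e (rename \<sigma> \<phi>) \<longleftrightarrow> sat \<AA> (e \<circ> \<sigma>) \<phi>"
proof (induction \<phi> arbitrary: e)
  case (Ex i \<phi>)
  have "e(\<sigma> i := x) \<circ> \<sigma> = (e \<circ> \<sigma>)(i := x)" for x
    using Ex.prems by (auto simp: fun_eq_iff dest: injD)
  then have "sat \<AA> (e(\<sigma> i := x)) (rename \<sigma> \<phi>) \<longleftrightarrow> sat \<AA> ((e \<circ> \<sigma>)(i := x)) \<phi>" for x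
    by (simp only: Ex.IH[OF Ex.prems])
  then show ?case by (simp only: rename.simps sat.simps)
qed (auto simp: comp_def)

section \<open>Pairwise distinctness as a formula\<close>

definition distinct_form :: "nat \<Rightarrow> 'r form" where
  "distinct_form m =
     foldr Conj [Neg (Eq i j). i \<leftarrow> [0..<m], j \<leftarrow> [0..<i]] (Neg Falsum)"

lemma free_vars_foldr_Conj:
  "free_vars (foldr Conj \<phi>s \<psi>) = (\<Union>\<phi> \<in> set \<phi>s. free_vars \<phi>) \<union> free_vars \<psi>"
  by (induction \<phi>s) auto

lemma in_L_foldr_Conj:
  "in_L n W ar (foldr Conj \<phi>s \<psi>) \<longleftrightarrow> (\<forall>\<phi> \<in> set \<phi>s. in_L n W ar \<phi>) \<and> in_L n W ar \<psi>"
  by (induction \<phi>s) auto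

lemma sat_foldr_Conj:
  "sat \<AA> e (foldr Conj \<phi>s \<psi>) \<longleftrightarrow> (\<forall>\<phi> \<in> set \<phi>s. sat \<AA> e \<phi>) \<and> sat \<AA> e \<psi>"
  by (induction \<phi>s) auto

lemma distinct_form_L_forms: "m \<le> n \<Longrightarrow> distinct_form m \<in> L_forms n \<AA> m"
  by (auto simp: L_forms_def distinct_form_def free_vars_foldr_Conj in_L_foldr_Conj)

lemma sat_distinct_form: "sat \<AA> e (distinct_form m) \<longleftrightarrow> inj_on e {..<m}"
proof -
  have "sat \<AA> e (distinct_form m) \<longleftrightarrow> (\<forall>i<m. \<forall>j<i. e i \<noteq> e j)"
    by (auto simp: distinct_form_def sat_foldr_Conj)
  also have "\<dots> \<longleftrightarrow> inj_on e {..<m}"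
  proof
    assume distinct: "\<forall>i<m. \<forall>j<i. e i \<noteq> e j"
    show "inj_on e {..<m}"
      by (rule linorder_inj_onI) (use distinct in force)+
  qed (fastforce simp: inj_on_def)
  finally show ?thesis .
qed

section \<open>Permutations of the universe and the core\<close>

text \<open>The extension is built point by point: a permutation that is correct on \<open>S\<close>
  is corrected at a new point \<open>x\<close> by composing it with the transposition of
  \<open>f x\<close> and \<open>g x\<close>. These two lie on the same side of \<open>U\<close>, so
  the correction respects \<open>U\<close>.\<close>

lemma extend_partial_injection:
  assumes "finite S" "S \<subseteq> A" "inj_on g S" "g ` S \<subseteq> A" "\<And>x. x \<in> S \<Longrightarrow> g x \<in> U \<longleftrightarrow> x \<in> U"
  shows "\<exists>f. bij_betw f A A \<and> (\<forall>x \<in> A. f x \<in> U \<longleftrightarrow> x \<in> U) \<and> (\<forall>x \<in> S. f x = g x)"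
  using assms
proof (induction S)
  case empty
  show ?case by (rule exI[of _ id]) (simp add: bij_betw_def)
next
  case (insert x S)
  then obtain f where f: "bij_betw f A A" "\<And>w. w \<in> A \<Longrightarrow> f w \<in> U \<longleftrightarrow> w \<in> U"
      "\<And>w. w \<in> S \<Longrightarrow> f w = g w"
    by auto
  let ?t = "transpose (f x) (g x)"
  have fA: "f w \<in> A" if "w \<in> A" for w using f(1) that by (auto simp: bij_betw_def)
  have xA: "x \<in> A" and gA: "g x \<in> A" using insert.prems by auto
  have tU: "?t y \<in> U \<longleftrightarrow> y \<in> U" for y
    using f(2)[OF xA] insert.prems(4)[of x] by (auto simp: transpose_def)
  have "bij_betw ?t A A"
    using fA[OF xA] gA by (intro bij_betw_byWitness[of _ ?t]) (auto simp: transpose_def)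
  then have "bij_betw (?t \<circ> f) A A" using f(1) by (rule bij_betw_trans[rotated])
  \<comment> \<open>Earlier values survive: for \<open>w\<close> in \<open>S\<close>,
    \<open>f w = g w\<close> differs from \<open>g x\<close> as \<open>g\<close> is injective and
    from \<open>f x\<close> as \<open>f\<close> is, so the transposition fixes it.\<close>
  moreover have "(?t \<circ> f) w = g w" if w: "w \<in> insert x S" for w
  proof (cases "w = x")
    case False
    then have "w \<in> S" using w by simp
    moreover have "g w \<noteq> g x" using inj_onD[OF insert.prems(2), of w x] False w by blast
    moreover have "f w \<noteq> f x"
      using f(1) False xA w insert.prems(1) by (auto simp: bij_betw_def dest: inj_onD)
    ultimately show ?thesis using f(3) by (auto simp: transpose_def)
  qed simp
  moreover have "(?t \<circ> f) w \<in> U \<longleftrightarrow> w \<in> U" if "w \<in> A" for w using f(2) tU that by simp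
  ultimately show ?case by blast
qed

text \<open>Equality of kernels makes the map from entries of \<open>a\<close> to entries of
  \<open>b\<close> well defined and injective. Taking \<open>U\<close> empty leaves only the
  condition on kernels.\<close>

lemma sim_imp_ex_permutation:
  assumes "set a \<subseteq> A" "set b \<subseteq> A" "sim U a b"
  shows "\<exists>f. bij_betw f A A \<and> (\<forall>x \<in> A. f x \<in> U \<longleftrightarrow> x \<in> U) \<and> map f a = b"
proof -
  \<comment> \<open>Which position of \<open>x\<close> in \<open>a\<close> is chosen does not
    matter, by the equality of kernels.\<close>
  define g where "g x = b ! (SOME i. i < length a \<and> a ! i = x)" for x
  have len: "length a = length b" and
    ker: "\<And>i j. i < length a \<Longrightarrow> j < length a \<Longrightarrow> a ! i = a ! j \<longleftrightarrow> b ! i = b ! j" and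
    U: "\<And>i. i < length a \<Longrightarrow> a ! i \<in> U \<longleftrightarrow> b ! i \<in> U"
    using assms(3) by (fastforce simp: sim_def ker_def set_eq_iff)+
  have g: "g (a ! i) = b ! i" if "i < length a" for i
    using someI[of "\<lambda>j. j < length a \<and> a ! j = a ! i" i] that ker unfolding g_def by blast
  have "inj_on g (set a)"
  proof (rule inj_onI)
    fix x y assume "x \<in> set a" "y \<in> set a" and eq: "g x = g y"
    then obtain i j where "i < length a" "x = a ! i" "j < length a" "y = a ! j"
      by (metis in_set_conv_nth)
    then show "x = y" using eq g ker by simp
  qed
  moreover have "g ` set a \<subseteq> A"
    using g subsetD[OF assms(2) nth_mem] len by (auto simp: in_set_conv_nth)
  moreover have "g x \<in> U \<longleftrightarrow> x \<in> U" if "x \<in> set a" for x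
    using that g U by (auto simp: in_set_conv_nth)
  ultimately obtain f where f: "bij_betw f A A" "\<forall>x \<in> A. f x \<in> U \<longleftrightarrow> x \<in> U"
      "\<forall>x \<in> set a. f x = g x"
    using extend_partial_injection[of "set a" A g U] assms(1) by auto
  have "map f a = b" using f(3) g len by (intro nth_equalityI) auto
  then show ?thesis using f by blast
qed

text \<open>Such a permutation sends every tuple to a \<open>sim\<close>-equivalent one; closure of
  the basic relations is applied in both directions.\<close>

lemma core_preserving_automorphism:
  assumes "U_structure n \<AA> U" "bij_betw f (universe \<AA>) (universe \<AA>)"
    and "\<And>x. x \<in> universe \<AA> \<Longrightarrow> f x \<in> U \<longleftrightarrow> x \<in> U"
  shows "automorphism \<AA> f"
  unfolding automorphism_def
proof (intro conjI ballI)
  show "bij_betw f (universe \<AA>) (universe \<AA>)" by fact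
  fix r s assume r: "r \<in> vocab \<AA>" and s: "s \<in> tuples (arity \<AA> r) (universe \<AA>)"
  have nth: "s ! i \<in> universe \<AA>" if "i < length s" for i
    using s that by (auto simp: tuples_def subset_iff)
  have inj: "f x = f y \<longleftrightarrow> x = y" if "x \<in> universe \<AA>" "y \<in> universe \<AA>" for x y
    using assms(2) that by (auto simp: bij_betw_def dest: inj_onD)
  have sim: "sim U s (map f s)" "sim U (map f s) s"
    using nth inj assms(3) by (auto simp: sim_def ker_def)
  have "map f s \<in> tuples (arity \<AA> r) (universe \<AA>)"
    using s assms(2) by (auto simp: tuples_def bij_betw_def)
  then show "s \<in> interp \<AA> r \<longleftrightarrow> map f s \<in> interp \<AA> r"
    using assms(1) r s sim unfolding U_structure_def by blast
qed

section \<open>Definable relations when the core is undefinable\<close>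

text \<open>Permutations preserving the core show that the truth of \<phi> at a point depends only
  on its side of \<open>U\<close>. If the two sides differed, \<phi> or its negation would define
  \<open>U\<close>.\<close>

lemma definable_set_trivial:
  assumes U: "U_structure n \<AA> U" and undef: "\<not> definable_set n \<AA> U"
    and \<phi>: "\<phi> \<in> L_forms n \<AA> 1" and "x \<in> universe \<AA>" "y \<in> universe \<AA>"
    and "sat_tuple \<AA> \<phi> [x]"
  shows "sat_tuple \<AA> \<phi> [y]"
proof (rule ccontr)
  assume y: "\<not> sat_tuple \<AA> \<phi> [y]"
  have same: "sat_tuple \<AA> \<phi> [u] \<longleftrightarrow> sat_tuple \<AA> \<phi> [w]"
    if uw: "u \<in> universe \<AA>" "w \<in> universe \<AA>" "u \<in> U \<longleftrightarrow> w \<in> U" for u w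
  proof -
    have "sim U [u] [w]" using that by (auto simp: sim_def ker_def)
    then obtain f where f: "bij_betw f (universe \<AA>) (universe \<AA>)"
        "\<forall>x \<in> universe \<AA>. f x \<in> U \<longleftrightarrow> x \<in> U" "map f [u] = [w]"
      using sim_imp_ex_permutation[of "[u]" "universe \<AA>" "[w]" U] uw by auto
    have "sat \<AA> (f \<circ> (!) [u]) \<phi> \<longleftrightarrow> sat \<AA> ((!) [u]) \<phi>"
      using core_preserving_automorphism[OF U f(1)] f(2) \<phi> that
      by (intro sat_automorphism[where n = n]) (auto simp: L_forms_def)
    \<comment> \<open>The two assignments are known to agree only at \<open>0\<close>, the sole
      possible free variable.\<close>
    moreover have "sat \<AA> (f \<circ> (!) [u]) \<phi> \<longleftrightarrow> sat \<AA> ((!) [w]) \<phi>"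
      using \<phi> f(3) by (intro sat_cong) (auto simp: L_forms_def)
    ultimately show ?thesis by (simp add: sat_tuple_def)
  qed
  have sub: "U \<subseteq> universe \<AA>" using U by (simp add: U_structure_def)
  have def_by: "definable_set n \<AA> U"
    if "\<psi> \<in> L_forms n \<AA> 1" "\<And>u. u \<in> universe \<AA> \<Longrightarrow> sat_tuple \<AA> \<psi> [u] \<longleftrightarrow> u \<in> U" for \<psi>
    unfolding definable_set_def definable_def
    using that sub by (intro bexI[of _ \<psi>]) (auto simp: tuples_def length_Suc_conv)
  have xy: "x \<in> U \<longleftrightarrow> y \<notin> U" using same[of x y] assms(4-6) y by blast
  show False
  proof (cases "x \<in> U")
    case True
    then have "sat_tuple \<AA> \<phi> [u] \<longleftrightarrow> u \<in> U" if "u \<in> universe \<AA>" for u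
      using same[of u x] same[of u y] that assms(4-6) y xy by blast
    then show False using def_by[OF \<phi>] undef by blast
  next
    case False
    then have "sat_tuple \<AA> (Neg \<phi>) [u] \<longleftrightarrow> u \<in> U" if "u \<in> universe \<AA>" for u
      using same[of u x] same[of u y] that assms(4-6) y xy by (auto simp: sat_tuple_def)
    moreover have "Neg \<phi> \<in> L_forms n \<AA> 1" using \<phi> by (simp add: L_forms_def)
    ultimately show False using def_by undef by blast
  qed
qed

text \<open>Induction on \<open>m\<close>: strongness recovers an \<open>m\<close>-ary definable
  relation on distinct tuples from two of its projections, and each projection is given by a formula
  in \<open>m - 1\<close> free variables. Assignments replace tuples so that permuting coordinates
  is mere composition.\<close>

lemma definable_distinct_trivial:
  assumes strong: "strong_U_structure n \<AA> U" and undef: "\<not> definable_set n \<AA> U"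
    and "m \<le> n" "\<phi> \<in> L_forms n \<AA> m"
    and "inj_on e {..<m}" "e ` {..<m} \<subseteq> universe \<AA>"
    and "inj_on e' {..<m}" "e' ` {..<m} \<subseteq> universe \<AA>"
    and "sat \<AA> e \<phi>"
  shows "sat \<AA> e' \<phi>"
  using assms(3-)
proof (induction m arbitrary: \<phi> e e' rule: less_induct)
  case (less m)
  let ?A = "universe \<AA>"
  have U: "U_structure n \<AA> U" using strong by (simp add: strong_U_structure_def)
  have fv: "free_vars \<phi> \<subseteq> {..<m}" using less.prems by (simp add: L_forms_def)
  consider "m = 0" | "m = 1" | "2 \<le> m" by linarith
  then show ?case
  proof cases
    case 1
    \<comment> \<open>Here \<phi> is a sentence, so the assignment is irrelevant.\<close>
    then show ?thesis using fv less.prems sat_cong[of \<phi> e e'] by auto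
  next
    case 2
    have "sat_tuple \<AA> \<phi> [e 0]"
      using sat_tuple_map_upt[OF fv, of \<AA> e] 2 less.prems by simp
    then have "sat_tuple \<AA> \<phi> [e' 0]"
      using definable_set_trivial[OF U undef, of \<phi> "e 0" "e' 0"] less.prems 2 by auto
    then show ?thesis using sat_tuple_map_upt[OF fv, of \<AA> e'] 2 by simp
  next
    case 3
    \<comment> \<open>Strongness speaks only of relations on distinct tuples, hence the second
      conjunct.\<close>
    define \<psi> where "\<psi> = Conj \<phi> (distinct_form m)"
    have \<psi>: "\<psi> \<in> L_forms n \<AA> m"
      using less.prems distinct_form_L_forms[of m n \<AA>] by (auto simp: \<psi>_def L_forms_def)
    have sat_e: "sat \<AA> e \<psi>" using less.prems by (simp add: \<psi>_def sat_distinct_form)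
    define R where "R = {s \<in> tuples m ?A. sat_tuple \<AA> \<psi> s}"
    have R_iff: "map d [0..<m] \<in> R \<longleftrightarrow> d ` {..<m} \<subseteq> ?A \<and> sat \<AA> d \<psi>" for d
      using sat_tuple_map_upt[of \<psi> m] \<psi>
      by (auto simp: R_def tuples_def L_forms_def)
    have R_distinct: "R \<subseteq> distinct_tuples m ?A"
    proof
      fix s assume s: "s \<in> R"
      then have "inj_on ((!) s) {..<m}"
        by (simp add: R_def sat_tuple_def \<psi>_def sat_distinct_form)
      then show "s \<in> distinct_tuples m ?A"
        using s by (auto simp: R_def distinct_tuples_def tuples_def distinct_conv_nth inj_on_def)
    qed
    have R_definable: "definable n (reduct \<AA> (vocab \<AA>)) m R"
      using \<psi> by (auto simp: definable_def reduct_def R_def)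
    \<comment> \<open>By the transposition exchanging \<open>i\<close> with the last variable, the induction hypothesis
      applies to the projection of \<open>R\<close> along any coordinate \<open>i\<close>.\<close>
    have proj: "\<exists>x \<in> ?A. (map e' [0..<m])[i := x] \<in> R" if i: "i < m" for i
    proof -
      let ?t = "transpose i (m - 1)"
      let ?\<chi> = "Ex (m - 1) (rename ?t \<psi>)"
      have t_less: "?t j < l" if "j < l" "m \<le> l" for j l
        using that i by (auto simp: transpose_def)
      have t_lt_m: "?t ` {..<m - 1} \<subseteq> {..<m}" using t_less[of _ m] by auto
      have \<chi>: "?\<chi> \<in> L_forms n \<AA> (m - 1)"
      proof -
        have "in_L n (vocab \<AA>) (arity \<AA>) (rename ?t \<psi>)"
          using \<psi> t_less[of _ n] less.prems(1) by (intro in_L_rename) (auto simp: L_forms_def)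
        moreover have "?t ` free_vars \<psi> - {m - 1} \<subseteq> {..<m - 1}"
        proof
          fix j assume j: "j \<in> ?t ` free_vars \<psi> - {m - 1}"
          then have "j < m" using \<psi> t_less[of _ m] by (auto simp: L_forms_def)
          then show "j \<in> {..<m - 1}" using j by auto
        qed
        ultimately show ?thesis
          using less.prems(1) i by (simp add: L_forms_def free_vars_rename)
      qed
      have inj: "inj_on (d \<circ> ?t) {..<m - 1}" if "inj_on d {..<m}" for d :: "nat \<Rightarrow> 'a"
        using that t_lt_m by (intro comp_inj_on) (auto intro: inj_on_subset)
      have sub: "(d \<circ> ?t) ` {..<m - 1} \<subseteq> ?A" if "d ` {..<m} \<subseteq> ?A" for d
        using that t_lt_m by (auto simp: image_subset_iff)
      have sat_\<chi>: "sat \<AA> (e \<circ> ?t) ?\<chi>"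
      proof -
        \<comment> \<open>The witness for the quantifier is \<open>e i\<close>, the coordinate that
          the transposition moved to the last place.\<close>
        have "(e \<circ> ?t)(m - 1 := e i) \<circ> ?t = e" by (auto simp: fun_eq_iff transpose_def)
        then show ?thesis
          using sat_e i less.prems(4)
          unfolding sat.simps sat_rename[OF inj_on_transpose] by (metis imageI lessThan_iff subsetD)
      qed
      have "sat \<AA> (e' \<circ> ?t) ?\<chi>"
        using 3 less.prems(1)
        by (intro less.IH[OF _ _ \<chi> inj[OF less.prems(3)] sub[OF less.prems(4)]
              inj[OF less.prems(5)] sub[OF less.prems(6)] sat_\<chi>]) auto
      then obtain x where x: "x \<in> ?A" "sat \<AA> ((e' \<circ> ?t)(m - 1 := x) \<circ> ?t) \<psi>"
        unfolding sat.simps sat_rename[OF inj_on_transpose] by blast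
      have "(e' \<circ> ?t)(m - 1 := x) \<circ> ?t = e'(i := x)"
        by (auto simp: fun_eq_iff transpose_def)
      moreover have "(map e' [0..<m])[i := x] = map (e'(i := x)) [0..<m]"
        using i by (intro nth_equalityI) (auto simp: nth_list_update)
      moreover have "e'(i := x) ` {..<m} \<subseteq> ?A" using x(1) less.prems(6) by auto
      ultimately show ?thesis using x R_iff[of "e'(i := x)"] by metis
    qed
    have e'_distinct: "map e' [0..<m] \<in> distinct_tuples m ?A"
      using less.prems by (auto simp: distinct_tuples_def tuples_def distinct_map atLeast0LessThan)
    \<comment> \<open>Strongness is applied with the full vocabulary and the coordinates
      \<open>0\<close> and \<open>1\<close>, distinct and available since \<open>m\<close> is at
      least 2.\<close>
    have "map e' [0..<m] \<in> R \<longleftrightarrow>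
        (\<exists>x \<in> ?A. (map e' [0..<m])[0 := x] \<in> R) \<and>
        (\<exists>x \<in> ?A. (map e' [0..<m])[1 := x] \<in> R) \<and> map e' [0..<m] \<in> distinct_tuples m ?A"
    proof -
      have "\<not> definable_set n (reduct \<AA> (vocab \<AA>)) U"
        using undef by (simp add: reduct_def)
      moreover have "map e' [0..<m] \<in> tuples m ?A"
        using e'_distinct by (simp add: distinct_tuples_def)
      moreover have "0 < m" "1 < m" "(0::nat) \<noteq> 1" using 3 by auto
      ultimately show ?thesis
        using strong[unfolded strong_U_structure_def, THEN conjunct2, rule_format,
            OF subset_refl _ less.prems(1) R_distinct, of 0 1 "map e' [0..<m]"] R_definable by blast
    qed
    then have "map e' [0..<m] \<in> R" using proj[of 0] proj[of 1] 3 e'_distinct by simp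
    then show ?thesis using R_iff by (simp add: \<psi>_def)
  qed
qed

text \<open>A tuple with repetitions is a distinct tuple read through repeated variables. An atomic
  formula with repeated variables thus reduces membership in a basic relation to the dichotomy for
  distinct tuples.\<close>

lemma permutation_automorphism:
  assumes strong: "strong_U_structure n \<AA> U" and undef: "\<not> definable_set n \<AA> U"
    and f: "bij_betw f (universe \<AA>) (universe \<AA>)"
  shows "automorphism \<AA> f"
  unfolding automorphism_def
proof (intro conjI ballI)
  show "bij_betw f (universe \<AA>) (universe \<AA>)" by fact
  fix r s assume r: "r \<in> vocab \<AA>" and s: "s \<in> tuples (arity \<AA> r) (universe \<AA>)"
  define t where "t = remdups s"
  define m where "m = length t"
  have t: "distinct t" "set t = set s" by (auto simp: t_def)
  then have "\<forall>x \<in> set s. \<exists>i < m. t ! i = x" by (metis in_set_conv_nth m_def)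
  then obtain h where h: "\<And>x. x \<in> set s \<Longrightarrow> h x < m \<and> t ! h x = x" by metis
  have "m \<le> length s" by (simp add: m_def t_def)
  \<comment> \<open>This rests on the bound \<open>n\<close> for the arities.\<close>
  then have m: "m \<le> n"
    using strong r s by (fastforce simp: strong_U_structure_def U_structure_def tuples_def)
  define \<phi> where "\<phi> = Rel r (map h s)"
  have \<phi>: "\<phi> \<in> L_forms n \<AA> m"
    using r s h m by (fastforce simp: \<phi>_def L_forms_def tuples_def)
  let ?e = "(!) t" and ?e' = "f \<circ> (!) t"
  have e: "inj_on ?e {..<m}" "?e ` {..<m} \<subseteq> universe \<AA>"
    using t s by (auto simp: inj_on_def m_def nth_eq_iff_index_eq tuples_def)
  then have e': "inj_on ?e' {..<m}" "?e' ` {..<m} \<subseteq> universe \<AA>"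
    using f by (auto simp: bij_betw_def intro!: comp_inj_on intro: inj_on_subset)
  have "map ?e (map h s) = s" "map ?e' (map h s) = map f s"
    using h by (auto intro!: map_idI)
  then have "sat \<AA> ?e \<phi> \<longleftrightarrow> s \<in> interp \<AA> r" "sat \<AA> ?e' \<phi> \<longleftrightarrow> map f s \<in> interp \<AA> r"
    unfolding \<phi>_def sat.simps by (simp_all only:)
  \<comment> \<open>The dichotomy is used twice, with the roles of the two assignments
    exchanged.\<close>
  then show "s \<in> interp \<AA> r \<longleftrightarrow> map f s \<in> interp \<AA> r"
    using definable_distinct_trivial[OF strong undef m \<phi>] e e' by blast
qed

theorem theorem2p7:
  fixes \<AA> :: "('a, 'r) rel_structure" and U\<^sub>0 :: "'a set" and n k :: nat and a b :: "'a list"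
  assumes "strong_U_structure n \<AA> U\<^sub>0"
    and "k \<le> n"
    and "a \<in> tuples k (universe \<AA>)"
    and "b \<in> tuples k (universe \<AA>)"
    and "\<And>\<phi>. \<phi> \<in> L_forms n \<AA> k \<Longrightarrow> sat_tuple \<AA> \<phi> a \<longleftrightarrow> sat_tuple \<AA> \<phi> b"
  shows "\<exists>f. automorphism \<AA> f \<and> map f a = b"
proof -
  have ab: "length a = k" "length b = k" "set a \<subseteq> universe \<AA>" "set b \<subseteq> universe \<AA>"
    using assms(3,4) by (auto simp: tuples_def)
  have "a ! i = a ! j \<longleftrightarrow> b ! i = b ! j" if "i < k" "j < k" for i j
    using assms(5)[of "Eq i j"] that assms(2) by (simp add: L_forms_def sat_tuple_def)
  then have ker: "ker a = ker b" using ab by (auto simp: ker_def)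
  show ?thesis
  proof (cases "definable_set n \<AA> U\<^sub>0")
    case False
    \<comment> \<open>With an undefinable core any permutation will do, so the side condition is
      made vacuous by the empty set.\<close>
    have "sim {} a b" using ker ab by (simp add: sim_def)
    then obtain f where "bij_betw f (universe \<AA>) (universe \<AA>)" "map f a = b"
      using sim_imp_ex_permutation[OF ab(3,4)] by blast
    then show ?thesis using permutation_automorphism[OF assms(1) False] by blast
  next
    case True
    then obtain \<phi> where \<phi>: "\<phi> \<in> L_forms n \<AA> 1"
        "{[x] | x. x \<in> U\<^sub>0} = {s \<in> tuples 1 (universe \<AA>). sat_tuple \<AA> \<phi> s}"
      by (auto simp: definable_set_def definable_def)
    have U\<^sub>0_iff: "x \<in> U\<^sub>0 \<longleftrightarrow> sat_tuple \<AA> \<phi> [x]" if "x \<in> universe \<AA>" for x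
    proof -
      have "[x] \<in> {[x] | x. x \<in> U\<^sub>0} \<longleftrightarrow> sat_tuple \<AA> \<phi> [x]"
        unfolding \<phi>(2) using that by (simp add: tuples_def)
      then show ?thesis by simp
    qed
    have "a ! i \<in> U\<^sub>0 \<longleftrightarrow> b ! i \<in> U\<^sub>0" if i: "i < k" for i
    proof -
      \<comment> \<open>This formula says that the i-th variable lies in the core. Swapping
        \<open>0\<close> and \<open>i\<close> keeps all variables below \<open>n\<close>, as
        \<open>i < k\<close> and \<open>k \<le> n\<close>.\<close>
      let ?\<psi> = "rename (transpose 0 i) \<phi>"
      have "in_L n (vocab \<AA>) (arity \<AA>) ?\<psi>"
        using \<phi>(1) i assms(2)
        by (intro in_L_rename) (auto simp: L_forms_def transpose_def)
      moreover have "free_vars ?\<psi> \<subseteq> {..<k}"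
        using \<phi>(1) i by (auto simp: L_forms_def free_vars_rename)
      ultimately have "sat_tuple \<AA> ?\<psi> a \<longleftrightarrow> sat_tuple \<AA> ?\<psi> b"
        using assms(5) by (simp add: L_forms_def)
      moreover have "sat_tuple \<AA> ?\<psi> c \<longleftrightarrow> sat_tuple \<AA> \<phi> [c ! i]" for c
        unfolding sat_tuple_def sat_rename[OF inj_on_transpose]
        using \<phi>(1) by (intro sat_cong) (auto simp: L_forms_def)
      ultimately show ?thesis
        using U\<^sub>0_iff subsetD[OF ab(3) nth_mem] subsetD[OF ab(4) nth_mem] i ab(1,2) by simp
    qed
    then have "sim U\<^sub>0 a b" using ker ab by (simp add: sim_def)
    then obtain f where f: "bij_betw f (universe \<AA>) (universe \<AA>)"
        "\<forall>x \<in> universe \<AA>. f x \<in> U\<^sub>0 \<longleftrightarrow> x \<in> U\<^sub>0" "map f a = b"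
      using sim_imp_ex_permutation[OF ab(3,4)] by blast
    have "U_structure n \<AA> U\<^sub>0" using assms(1) by (simp add: strong_U_structure_def)
    then show ?thesis using core_preserving_automorphism[OF _ f(1)] f(2,3) by blast
  qed
qed

end
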